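(* Let $G$ be a graph of order $n$ and $\overline{G}$ its complement, and let $\phi(n)=\sqrt{2n^2-2n+1}$. Then for every integer $k$ with $1\le k\le n-\frac{\phi(n)+1}{2}$ or $\frac{\phi(n)-1}{2}\le k\le n-2$, $$s_k(G)+s_k(\overline{G})<\binom{n}{2}+2\binom{k+1}{2}.$$
   Context: All graphs are finite, simple and undirected. For a graph $H$ on $n$ vertices, $L(H)=D(H)-A(H)$ is its Laplacian matrix with eigenvalues $\mu_1(H)\ge\dots\ge\mu_n(H)$, and $s_k(H)=\sum_{i=1}^k\mu_i(H)$. $\overline{G}$ denotes the complement of $G$. *)

theory Defs
  imports
    Complex_Main
    "Jordan_Normal_Form.Char_Poly"
    "HOL-Library.Multiset"
    "HOL-Computational_Algebra.Polynomial"
begin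

text \<open>
  A finite simple undirected graph is given by a finite vertex set \<open>V\<close> and a set \<open>E\<close> of
  two-element subsets of \<open>V\<close>.
\<close>

definition simple_graph :: "'a set \<Rightarrow> 'a set set \<Rightarrow> bool" where
  "simple_graph V E \<longleftrightarrow> finite V \<and> (\<forall>e\<in>E. e \<subseteq> V \<and> card e = 2)"

definition complement_edges :: "'a set \<Rightarrow> 'a set set \<Rightarrow> 'a set set" where
  "complement_edges V E = {e. e \<subseteq> V \<and> card e = 2 \<and> e \<notin> E}"

definition degree_of :: "'a set set \<Rightarrow> 'a \<Rightarrow> nat" where
  "degree_of E v = card {e \<in> E. v \<in> e}"

text \<open>
  Writing down the matrices of a graph requires an ordering of its vertices. An arbitrary one is
  chosen; a different choice conjugates the matrices by a permutation matrix and leaves the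
  characteristic polynomial unchanged. The choice depends on \<open>V\<close> only, so a graph and its
  complement are represented with respect to the same ordering.
\<close>

definition vertex_list :: "'a set \<Rightarrow> 'a list" where
  "vertex_list V = (SOME vs. distinct vs \<and> set vs = V)"

definition degree_matrix :: "'a set \<Rightarrow> 'a set set \<Rightarrow> real mat" where
  "degree_matrix V E = mat (card V) (card V)
     (\<lambda>(i, j). if i = j then real (degree_of E (vertex_list V ! i)) else 0)"

definition adjacency_matrix :: "'a set \<Rightarrow> 'a set set \<Rightarrow> real mat" where
  "adjacency_matrix V E = mat (card V) (card V)
     (\<lambda>(i, j). if {vertex_list V ! i, vertex_list V ! j} \<in> E then 1 else 0)"

definition laplacian_matrix :: "'a set \<Rightarrow> 'a set set \<Rightarrow> real mat" where
  "laplacian_matrix V E = degree_matrix V E - adjacency_matrix V E"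

text \<open>
  The eigenvalues, repeated according to multiplicity and in non-increasing order. As the Laplacian
  matrix is real symmetric, its characteristic polynomial splits over the reals, and the list has
  length \<^term>\<open>card V\<close>. The list is indexed from 0, the eigenvalues \<open>\<mu>\<^sub>i\<close> from 1.
\<close>

definition laplacian_eigenvalues :: "'a set \<Rightarrow> 'a set set \<Rightarrow> real list" where
  "laplacian_eigenvalues V E =
     rev (sorted_list_of_multiset (proots (char_poly (laplacian_matrix V E))))"

definition laplacian_eigenvalue :: "'a set \<Rightarrow> 'a set set \<Rightarrow> nat \<Rightarrow> real" where
  "laplacian_eigenvalue V E i = laplacian_eigenvalues V E ! (i - 1)"

definition laplacian_eigenvalue_sum :: "nat \<Rightarrow> 'a set \<Rightarrow> 'a set set \<Rightarrow> real" where
  "laplacian_eigenvalue_sum k V E = (\<Sum>i=1..k. laplacian_eigenvalue V E i)"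

definition phi :: "nat \<Rightarrow> real" where
  "phi n = sqrt (2 * (real n)\<^sup>2 - 2 * real n + 1)"

end

theory Submission
  imports Defs "Jordan_Normal_Form.Schur_Decomposition"
begin

text \<open>
  Two bounds on \<open>s\<^sub>k\<close> suffice. Since Laplacian eigenvalues lie in \<open>[0, n]\<close>, both
  \<open>s\<^sub>k(G)\<close> and \<open>s\<^sub>k\<close> of the complement are at most \<open>k n\<close> and at most the respective traces,
  which add up to \<open>n (n - 1)\<close>. The first range of \<open>k\<close> says exactly that
  \<open>2 k n\<close> is at most the right-hand side, the second that \<open>n (n - 1)\<close> is.

  Equality in either bound would give two non-constant functions on the vertices, one constant along
  the edges of \<open>G\<close> and one along those of the complement: an eigenvector of \<open>G\<close> for \<open>n\<close> is
  orthogonal to the constants and constant along non-edges, and if 0 is a multiple root of the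
  characteristic polynomial then the kernel contains a non-constant vector. Every pair of vertices is
  then identified by one of the two functions, which forces one of them to be constant.
\<close>

section \<open>Traces and spectra of real symmetric matrices\<close>

lemma trace_mult_commute:
  fixes A B :: "'a :: comm_semiring_0 mat"
  assumes "A \<in> carrier_mat n n" "B \<in> carrier_mat n n"
  shows "(\<Sum>i<n. (A * B) $$ (i, i)) = (\<Sum>i<n. (B * A) $$ (i, i))"
proof -
  have *: "(\<Sum>i<n. (A * B) $$ (i, i)) = (\<Sum>i<n. \<Sum>j<n. A $$ (i, j) * B $$ (j, i))"
    if "A \<in> carrier_mat n n" "B \<in> carrier_mat n n" for A B :: "'a mat"
    using that by (intro sum.cong) (auto simp: scalar_prod_def lessThan_atLeast0)
  show ?thesis
    unfolding *[OF assms] *[OF assms(2,1)]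
    by (subst sum.swap) (simp add: mult.commute)
qed

text \<open>Schur decomposition writes \<open>A\<close> as \<open>P * B * Q\<close> with
  \<open>Q * P\<close> the identity and \<open>B\<close> upper triangular with diagonal
  \<open>es\<close>. The trace is unchanged when the factors are permuted cyclically.\<close>

lemma trace_eq_sum_list_eigenvalues:
  fixes A :: "'a :: conjugatable_ordered_field mat"
  assumes A: "A \<in> carrier_mat n n"
    and "char_poly A = (\<Prod>a\<leftarrow>es. [:- a, 1:])"
  shows "(\<Sum>i<n. A $$ (i, i)) = sum_list es"
proof -
  obtain B P Q where "schur_decomposition A es = (B, P, Q)"
    by (cases "schur_decomposition A es") auto
  from schur_decomposition[OF assms this]
  have sim: "similar_mat_wit A B P Q" and diag: "diag_mat B = es" by auto
  note w = similar_mat_witD2[OF A sim]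
  have "(\<Sum>i<n. A $$ (i, i)) = (\<Sum>i<n. (P * (B * Q)) $$ (i, i))"
    using w by simp
  also have "\<dots> = (\<Sum>i<n. ((B * Q) * P) $$ (i, i))"
    using w by (intro trace_mult_commute) auto
  also have "(B * Q) * P = B"
    using w by (simp add: assoc_mult_mat[of _ n n _ n _ n])
  also have "(\<Sum>i<n. B $$ (i, i)) = sum_list (diag_mat B)"
    using w by (auto simp: diag_mat_def interv_sum_list_conv_sum_set_nat lessThan_atLeast0)
  finally show ?thesis by (simp add: diag)
qed

text \<open>For an eigenvector \<open>v\<close>, the Hermitian form \<open>s\<close> of
  \<open>A\<close> at \<open>v\<close> equals \<open>x * q\<close>, where \<open>q\<close> is the
  squared norm. Symmetry makes \<open>s\<close> its own conjugate, and \<open>q > 0\<close>, so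
  \<open>x\<close> equals its conjugate.\<close>

lemma symmetric_real_mat_complex_eigenvalue_real:
  fixes A :: "real mat"
  assumes A: "A \<in> carrier_mat n n"
    and sym: "\<And>i j. i < n \<Longrightarrow> j < n \<Longrightarrow> A $$ (i, j) = A $$ (j, i)"
    and ev: "eigenvalue (map_mat complex_of_real A) x"
  shows "x \<in> \<real>"
proof -
  let ?C = "map_mat complex_of_real A"
  obtain v where v: "v \<in> carrier_vec n" "v \<noteq> 0\<^sub>v n" "?C *\<^sub>v v = x \<cdot>\<^sub>v v"
    using ev A by (auto simp: eigenvalue_def eigenvector_def)
  define s where "s = (\<Sum>i<n. \<Sum>j<n. cnj (v $ i) * A $$ (i, j) * v $ j)"
  define q where "q = (\<Sum>i<n. (cmod (v $ i))\<^sup>2)"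
  have row: "(\<Sum>j<n. A $$ (i, j) * v $ j) = x * v $ i" if "i < n" for i
  proof -
    have "(\<Sum>j<n. A $$ (i, j) * v $ j) = (?C *\<^sub>v v) $ i"
      using that A v(1) by (auto simp: scalar_prod_def lessThan_atLeast0)
    then show ?thesis using that v by simp
  qed
  have "s = (\<Sum>i<n. cnj (v $ i) * (x * v $ i))"
    unfolding s_def by (intro sum.cong) (auto simp: row[symmetric] sum_distrib_left mult.assoc)
  also have "\<dots> = x * of_real q"
    unfolding q_def of_real_sum sum_distrib_left
    by (intro sum.cong) (simp_all only: complex_norm_square mult_ac)
  finally have sx: "s = x * of_real q" .
  have "cnj s = (\<Sum>i<n. \<Sum>j<n. cnj (v $ j) * A $$ (i, j) * v $ i)"
    by (simp add: s_def mult_ac)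
  also have "\<dots> = (\<Sum>j<n. \<Sum>i<n. cnj (v $ j) * A $$ (i, j) * v $ i)"
    by (rule sum.swap)
  also have "\<dots> = s"
    unfolding s_def by (intro sum.cong refl) (auto simp: sym)
  finally have "cnj x * of_real q = x * of_real q" by (simp add: sx)
  moreover obtain i where "i < n" "v $ i \<noteq> 0"
    using v(1,2) by (metis carrier_vecD eq_vecI index_zero_vec)
  then have "q > 0" unfolding q_def by (intro sum_pos2[of _ i]) auto
  ultimately have "cnj x = x" by simp
  then show ?thesis by (simp add: Reals_cnj_iff)
qed

text \<open>The polynomial splits over the complex numbers, and the previous lemma makes every root
  real. The factorisation descends to the reals because the embedding is injective on
  coefficients.\<close>

lemma symmetric_real_mat_char_poly_splits:
  fixes A :: "real mat"
  assumes A: "A \<in> carrier_mat n n"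
    and sym: "\<And>i j. i < n \<Longrightarrow> j < n \<Longrightarrow> A $$ (i, j) = A $$ (j, i)"
  obtains es where "char_poly A = (\<Prod>a\<leftarrow>es. [:- a, 1:])"
proof -
  let ?C = "map_mat complex_of_real A"
  have C: "?C \<in> carrier_mat n n" using A by simp
  obtain as where as: "char_poly ?C = (\<Prod>a\<leftarrow>as. [:- a, 1:])"
    using char_poly_factorized[OF C] by blast
  have "a \<in> \<real>" if "a \<in> set as" for a
  proof (rule symmetric_real_mat_complex_eigenvalue_real[OF A sym])
    show "eigenvalue ?C a"
      unfolding eigenvalue_root_char_poly[OF C] as poly_prod_list prod_list_zero_iff
      using that by force
  qed auto
  then have "as = map complex_of_real (map Re as)"
    by (induction as) auto
  then have "map_poly complex_of_real (char_poly A)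
      = (\<Prod>a\<leftarrow>map complex_of_real (map Re as). [:- a, 1:])"
    unfolding of_real_hom.char_poly_hom[OF A, symmetric] as by metis
  moreover have "(\<Prod>a\<leftarrow>map complex_of_real rs. [:- a, 1:])
      = map_poly complex_of_real (\<Prod>a\<leftarrow>rs. [:- a, 1:])" for rs
  proof -
    interpret map_poly_comm_ring_hom complex_of_real ..
    show ?thesis by (induction rs) (simp_all only: list.map prod_list.Nil prod_list.Cons hom_one hom_mult, simp)
  qed
  ultimately have *: "map_poly complex_of_real (char_poly A)
      = map_poly complex_of_real (\<Prod>a\<leftarrow>map Re as. [:- a, 1:])"
    by (simp only:)
  have "char_poly A = (\<Prod>a\<leftarrow>map Re as. [:- a, 1:])"
  proof (rule poly_eqI)
    fix i
    show "coeff (char_poly A) i = coeff (\<Prod>a\<leftarrow>map Re as. [:- a, 1:]) i"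
      using arg_cong[OF *, of "\<lambda>p. coeff p i"] by (simp only: coeff_map_poly of_real_0 of_real_eq_iff)
  qed
  then show thesis by (rule that)
qed


section \<open>Laplacians of symmetric weight functions\<close>

text \<open>Laplacian of a weighted graph on the indices below \<open>n\<close>. A loop weight
  \<open>b i i\<close> cancels on the diagonal.\<close>

definition matrix_laplacian :: "nat \<Rightarrow> (nat \<Rightarrow> nat \<Rightarrow> real) \<Rightarrow> real mat" where
  "matrix_laplacian n b = mat n n (\<lambda>(i, j). (if i = j then \<Sum>l<n. b i l else 0) - b i j)"

lemma matrix_laplacian_carrier [simp]: "matrix_laplacian n b \<in> carrier_mat n n"
  and dim_matrix_laplacian [simp]: "dim_row (matrix_laplacian n b) = n" "dim_col (matrix_laplacian n b) = n"
  by (auto simp: matrix_laplacian_def)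

lemma matrix_laplacian_index:
  "i < n \<Longrightarrow> j < n \<Longrightarrow>
    matrix_laplacian n b $$ (i, j) = (if i = j then \<Sum>l<n. b i l else 0) - b i j"
  by (simp add: matrix_laplacian_def)

lemma matrix_laplacian_mult_vec:
  assumes "v \<in> carrier_vec n" "i < n"
  shows "(matrix_laplacian n b *\<^sub>v v) $ i = (\<Sum>j<n. b i j * (v $ i - v $ j))"
proof -
  have "(matrix_laplacian n b *\<^sub>v v) $ i = (\<Sum>j<n. matrix_laplacian n b $$ (i, j) * v $ j)"
    using assms by (auto simp: scalar_prod_def lessThan_atLeast0)
  also have "\<dots> = (\<Sum>j<n. (if i = j then (\<Sum>l<n. b i l) * v $ j else 0) - b i j * v $ j)"
    using assms by (intro sum.cong) (auto simp: matrix_laplacian_index left_diff_distrib)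
  also have "\<dots> = (\<Sum>l<n. b i l) * v $ i - (\<Sum>j<n. b i j * v $ j)"
    using assms by (simp add: sum_subtractf)
  also have "\<dots> = (\<Sum>j<n. b i j * (v $ i - v $ j))"
    by (simp add: sum_distrib_right sum_subtractf right_diff_distrib)
  finally show ?thesis .
qed

text \<open>The lower bound on the weights makes the quadratic form of the Laplacian nonnegative;
  the upper bound does the same for the complementary weights \<open>1 - b i j\<close>. From these
  come the eigenvalue bounds 0 and \<open>n\<close>.\<close>

locale weight_matrix =
  fixes n :: nat and b :: "nat \<Rightarrow> nat \<Rightarrow> real"
  assumes sym: "b i j = b j i"
    and nonneg: "0 \<le> b i j"
    and le_1: "b i j \<le> 1"
begin

abbreviation L :: "real mat" where "L \<equiv> matrix_laplacian n b"

lemma eigenvector_eq: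
  assumes "v \<in> carrier_vec n" "L *\<^sub>v v = x \<cdot>\<^sub>v v" "i < n"
  shows "(\<Sum>j<n. b i j * (v $ i - v $ j)) = x * v $ i"
  using matrix_laplacian_mult_vec[OF assms(1,3), of b] assms by simp

text \<open>Multiply row \<open>i\<close> of the eigenvalue equation by \<open>v $ i\<close> and sum
  over \<open>i\<close>. By symmetry of \<open>b\<close>, exchanging the indices replaces the last
  factor by \<open>- v $ j\<close>; adding both forms produces the squares.\<close>

lemma quadratic_form:
  assumes "v \<in> carrier_vec n" "L *\<^sub>v v = x \<cdot>\<^sub>v v"
  shows "2 * x * (\<Sum>i<n. (v $ i)\<^sup>2) = (\<Sum>i<n. \<Sum>j<n. b i j * (v $ i - v $ j)\<^sup>2)"
proof -
  have 1: "x * (\<Sum>i<n. (v $ i)\<^sup>2) = (\<Sum>i<n. \<Sum>j<n. b i j * (v $ i - v $ j) * v $ i)"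
    unfolding sum_distrib_left
  proof (intro sum.cong refl)
    fix i assume "i \<in> {..<n}"
    then show "x * (v $ i)\<^sup>2 = (\<Sum>j<n. b i j * (v $ i - v $ j) * v $ i)"
      using eigenvector_eq[OF assms, of i] by (simp add: sum_distrib_right[symmetric] power2_eq_square)
  qed
  also have "\<dots> = (\<Sum>j<n. \<Sum>i<n. b i j * (v $ i - v $ j) * v $ i)"
    by (rule sum.swap)
  also have "\<dots> = (\<Sum>i<n. \<Sum>j<n. - (b i j * (v $ i - v $ j) * v $ j))"
    by (intro sum.cong refl) (metis (no_types) sym minus_diff_eq mult_minus_left mult_minus_right)
  finally have 2: "x * (\<Sum>i<n. (v $ i)\<^sup>2) = (\<Sum>i<n. \<Sum>j<n. - (b i j * (v $ i - v $ j) * v $ j))" .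
  have "2 * x * (\<Sum>i<n. (v $ i)\<^sup>2) = x * (\<Sum>i<n. (v $ i)\<^sup>2) + x * (\<Sum>i<n. (v $ i)\<^sup>2)"
    by simp
  also have "\<dots> = (\<Sum>i<n. \<Sum>j<n. b i j * (v $ i - v $ j)\<^sup>2)"
    by (subst 1, subst 2)
      (simp add: sum.distrib[symmetric] power2_eq_square algebra_simps)
  finally show ?thesis .
qed

lemma eigenvalue_nonneg:
  assumes "eigenvalue L x"
  shows "0 \<le> x"
proof -
  obtain v where v: "v \<in> carrier_vec n" "v \<noteq> 0\<^sub>v n" "L *\<^sub>v v = x \<cdot>\<^sub>v v"
    using assms by (auto simp: eigenvalue_def eigenvector_def)
  obtain i where "i < n" "v $ i \<noteq> 0"
    using v(1,2) by (metis carrier_vecD eq_vecI index_zero_vec)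
  then have "(\<Sum>i<n. (v $ i)\<^sup>2) > 0" by (intro sum_pos2[of _ i]) auto
  moreover have "0 \<le> 2 * x * (\<Sum>i<n. (v $ i)\<^sup>2)"
    unfolding quadratic_form[OF v(1,3)] by (intro sum_nonneg mult_nonneg_nonneg) (auto simp: nonneg)
  ultimately show ?thesis by (simp add: zero_le_mult_iff)
qed

text \<open>The summand is antisymmetric in the two indices. In matrix terms, the columns of
  \<open>L\<close> sum to 0.\<close>

lemma sum_weighted_differences:
  fixes u :: "nat \<Rightarrow> real"
  shows "(\<Sum>i<n. \<Sum>j<n. b i j * (u i - u j)) = 0"
proof -
  let ?s = "\<Sum>i<n. \<Sum>j<n. b i j * (u i - u j)"
  have "?s = (\<Sum>j<n. \<Sum>i<n. b i j * (u i - u j))" by (rule sum.swap)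
  also have "\<dots> = (\<Sum>i<n. \<Sum>j<n. - (b i j * (u i - u j)))"
    by (intro sum.cong refl) (metis (no_types) sym minus_diff_eq mult_minus_right)
  also have "\<dots> = - ?s" by (simp add: sum_negf)
  finally show ?thesis by simp
qed

lemma sum_eigenvector:
  assumes "v \<in> carrier_vec n" "L *\<^sub>v v = x \<cdot>\<^sub>v v"
  shows "x * (\<Sum>i<n. v $ i) = 0"
proof -
  have "x * (\<Sum>i<n. v $ i) = (\<Sum>i<n. \<Sum>j<n. b i j * (v $ i - v $ j))"
    by (simp add: sum_distrib_left eigenvector_eq[OF assms])
  then show ?thesis by (simp only: sum_weighted_differences)
qed

text \<open>Expanding the squares evaluates the double sum with all weights 1; subtracting
  \<open>quadratic_form\<close> leaves the complementary weights. Both the eigenvalue bound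
  \<open>n\<close> and its equality case are read off from this identity.\<close>

lemma sum_complement_weights:
  fixes v :: "real vec" and x :: real
  assumes "v \<in> carrier_vec n" "L *\<^sub>v v = x \<cdot>\<^sub>v v"
  shows "(\<Sum>i<n. \<Sum>j<n. (1 - b i j) * (v $ i - v $ j)\<^sup>2)
    = 2 * (n - x) * (\<Sum>i<n. (v $ i)\<^sup>2) - 2 * (\<Sum>i<n. v $ i)\<^sup>2"
proof -
  have "(\<Sum>i<n. \<Sum>j<n. (v $ i - v $ j)\<^sup>2)
      = (\<Sum>i<n. \<Sum>j<n. (v $ i)\<^sup>2 + (v $ j)\<^sup>2 - 2 * (v $ i * v $ j))"
    by (intro sum.cong refl) (simp add: power2_diff)
  also have "\<dots> = 2 * n * (\<Sum>i<n. (v $ i)\<^sup>2) - 2 * (\<Sum>i<n. v $ i)\<^sup>2"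
    by (simp add: sum.distrib sum_subtractf sum_distrib_left[symmetric] power2_eq_square sum_product)
  finally show ?thesis
    using quadratic_form[OF assms]
    by (simp add: left_diff_distrib right_diff_distrib sum_subtractf)
qed

lemma eigenvalue_le:
  fixes x :: real
  assumes "eigenvalue L x"
  shows "x \<le> n"
proof -
  obtain v where v: "v \<in> carrier_vec n" "v \<noteq> 0\<^sub>v n" "L *\<^sub>v v = x \<cdot>\<^sub>v v"
    using assms by (auto simp: eigenvalue_def eigenvector_def)
  obtain i where "i < n" "v $ i \<noteq> 0"
    using v(1,2) by (metis carrier_vecD eq_vecI index_zero_vec)
  then have "(\<Sum>i<n. (v $ i)\<^sup>2) > 0" by (intro sum_pos2[of _ i]) auto
  moreover have "0 \<le> (\<Sum>i<n. \<Sum>j<n. (1 - b i j) * (v $ i - v $ j)\<^sup>2)"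
    by (intro sum_nonneg mult_nonneg_nonneg) (auto simp: le_1)
  \<comment> \<open>The square of the coordinate sum is subtracted in the identity, so dropping it
    preserves the lower bound 0.\<close>
  then have "0 \<le> 2 * (n - x) * (\<Sum>i<n. (v $ i)\<^sup>2)"
    using zero_le_power2[of "\<Sum>i<n. v $ i"]
    unfolding sum_complement_weights[OF v(1,3)] by linarith
  ultimately show ?thesis by (simp add: zero_le_mult_iff)
qed

text \<open>The coordinates of an eigenvector for \<open>n\<close> sum to 0, so its complementary
  form vanishes, and with it each of the nonnegative terms. A nonzero vector with coordinate sum 0
  is not constant.\<close>

lemma eigenvalue_eq_dim_nonconstant:
  assumes "eigenvalue L n"
  obtains v :: "nat \<Rightarrow> real" where
    "\<And>i j. i < n \<Longrightarrow> j < n \<Longrightarrow> b i j \<noteq> 1 \<Longrightarrow> v i = v j"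
    "\<exists>i<n. \<exists>j<n. v i \<noteq> v j"
proof -
  obtain v where v: "v \<in> carrier_vec n" "v \<noteq> 0\<^sub>v n" "L *\<^sub>v v = real n \<cdot>\<^sub>v v"
    using assms by (auto simp: eigenvalue_def eigenvector_def)
  obtain i where i: "i < n" "v $ i \<noteq> 0"
    using v(1,2) by (metis carrier_vecD eq_vecI index_zero_vec)
  have sum0: "(\<Sum>i<n. v $ i) = 0"
    using sum_eigenvector[OF v(1,3)] i by simp
  show thesis
  proof (rule that[of "\<lambda>i. v $ i"])
    fix i j assume ij: "i < n" "j < n" "b i j \<noteq> 1"
    have "(\<Sum>i<n. \<Sum>j<n. (1 - b i j) * (v $ i - v $ j)\<^sup>2) = 0"
      unfolding sum_complement_weights[OF v(1,3)] sum0 by simp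
    then have "(1 - b i j) * (v $ i - v $ j)\<^sup>2 = 0"
      using ij by (auto simp: sum_nonneg_eq_0_iff sum_nonneg le_1)
    then show "v $ i = v $ j" using ij by simp
  next
    show "\<exists>i<n. \<exists>j<n. v $ i \<noteq> v $ j"
    proof (rule ccontr)
      assume "\<not> ?thesis"
      then have "v $ j = v $ i" if "j \<in> {..<n}" for j using that i(1) by blast
      then have "(\<Sum>j<n. v $ j) = real n * v $ i" by (simp only: sum.cong sum_constant card_lessThan)
      then show False using i unfolding sum0 by simp
    qed
  qed
qed

text \<open>
  Let \<open>K\<close> have first column all ones and zeros elsewhere. Then \<open>L * K = 0\<close>, hence
  \<open>(x - L) * (x - K) = x * (x - L - K)\<close>, and taking determinants relates the characteristic
  polynomials of \<open>L\<close> and \<open>L + K\<close>. A kernel vector of \<open>L + K\<close> is a kernel vector of \<open>L\<close> that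
  vanishes in the first coordinate, so it is not constant.
\<close>

lemma char_poly_add_first_column:
  assumes "n > 0"
  defines "K \<equiv> mat n n (\<lambda>(i, j). if j = 0 then 1 else (0 :: real))"
  shows "char_poly L * [:- 1, 1:] = [:0, 1:] * char_poly (L + K)"
proof -
  have K: "K \<in> carrier_mat n n" by (simp add: K_def)
  have LK: "L * K = 0\<^sub>m n n"
  proof (rule eq_matI)
    fix i j assume "i < dim_row (0\<^sub>m n n :: real mat)" "j < dim_col (0\<^sub>m n n :: real mat)"
    then have ij: "i < n" "j < n" by auto
    have "(L * K) $$ (i, j) = (L *\<^sub>v col K j) $ i" using ij K by simp
    also have "\<dots> = 0"
      using ij K by (subst matrix_laplacian_mult_vec) (auto simp: K_def intro: sum.neutral)
    finally show "(L * K) $$ (i, j) = 0\<^sub>m n n $$ (i, j)" using ij by simp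
  qed (use K in auto)
  \<comment> \<open>\<open>K\<close> is lower triangular with diagonal 1, 0, ..., 0, so its
    transpose is upper triangular.\<close>
  have char_K: "char_poly K = [:- 1, 1:] * [:0, 1:] ^ (n - 1)"
  proof -
    have "char_poly K = char_poly (transpose_mat K)" using K by simp
    also have "\<dots> = (\<Prod>a\<leftarrow>diag_mat (transpose_mat K). [:- a, 1:])"
      by (rule char_poly_upper_triangular[of _ n]) (auto simp: K_def)
    also have "\<dots> = (\<Prod>i\<in>{0..<n}. if i = 0 then [:- 1, 1:] else [:0, 1:])"
      unfolding prod.distinct_set_conv_list[of "[0..<n]", simplified]
      by (auto simp: diag_mat_def K_def comp_def intro!: arg_cong[of _ _ prod_list])
    also have "\<dots> = [:- 1, 1:] * [:0, 1:] ^ (n - 1)"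
      using assms(1) by (subst prod.remove[of _ 0]) auto
    finally show ?thesis .
  qed
  have eval: "poly (char_poly A) x = det (x \<cdot>\<^sub>m 1\<^sub>m n - A)" if "A \<in> carrier_mat n n" for A :: "real mat" and x
    unfolding char_poly_matrix[OF that]
    by (rule arg_cong[of _ _ det]) (use that in \<open>auto simp: char_matrix_def\<close>)
  \<comment> \<open>Evaluation at a real \<open>x\<close> turns the polynomial identity into one
    between determinants of matrix products.\<close>
  have "poly (char_poly L * char_poly K) x = poly ([:0, 1:] ^ n * char_poly (L + K)) x" for x
  proof -
    have "(x \<cdot>\<^sub>m 1\<^sub>m n - L) * (x \<cdot>\<^sub>m 1\<^sub>m n - K) = x \<cdot>\<^sub>m (x \<cdot>\<^sub>m 1\<^sub>m n - (L + K))"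
    proof -
      let ?X = "x \<cdot>\<^sub>m 1\<^sub>m n"
      have X: "?X \<in> carrier_mat n n" and L: "L \<in> carrier_mat n n" by auto
      have "(?X - L) * (?X - K) = ?X * (?X - K) - L * (?X - K)"
        using X L K by (intro minus_mult_distrib_mat) auto
      also have "?X * (?X - K) = x \<cdot>\<^sub>m (?X - K)"
        using X K by (subst mult_smult_assoc_mat[of _ n n _ n]) auto
      also have "L * (?X - K) = L * ?X - L * K"
        using X L K by (intro mult_minus_distrib_mat) auto
      also have "L * ?X = x \<cdot>\<^sub>m L"
        by (subst mult_smult_distrib[of _ n n _ n]) auto
      also have "x \<cdot>\<^sub>m (?X - K) - (x \<cdot>\<^sub>m L - L * K) = x \<cdot>\<^sub>m (?X - (L + K))"
        unfolding LK using K by (intro eq_matI) (auto simp: algebra_simps)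
      finally show ?thesis .
    qed
    then have "det (x \<cdot>\<^sub>m 1\<^sub>m n - L) * det (x \<cdot>\<^sub>m 1\<^sub>m n - K)
        = x ^ n * det (x \<cdot>\<^sub>m 1\<^sub>m n - (L + K))"
      using K by (subst det_mult[symmetric, of _ n]) auto
    then show ?thesis
      using K by (simp add: eval)
  qed
  then have "char_poly L * char_poly K = [:0, 1:] ^ n * char_poly (L + K)"
    by (simp add: poly_eq_poly_eq_iff[symmetric] fun_eq_iff)
  \<comment> \<open>\<open>char_poly K\<close> supplies \<open>n - 1\<close> factors X, which cancel
    all but one of the \<open>n\<close> factors on the right.\<close>
  then have "[:0, 1:] ^ (n - 1) * (char_poly L * [:- 1, 1:])
      = [:0, 1:] ^ (n - 1) * ([:0, 1:] * char_poly (L + K))"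
    unfolding char_K using assms(1) by (cases n) (simp_all only: power_Suc diff_Suc_1 mult_ac)
  then show ?thesis by (subst (asm) mult_left_cancel) auto
qed

lemma order_0_nonconstant:
  assumes "Polynomial.order 0 (char_poly L) \<ge> 2"
  obtains v :: "nat \<Rightarrow> real" where
    "\<And>i j. i < n \<Longrightarrow> j < n \<Longrightarrow> b i j \<noteq> 0 \<Longrightarrow> v i = v j"
    "\<exists>i<n. \<exists>j<n. v i \<noteq> v j"
proof -
  have deg: "degree (char_poly L) = n" "monic (char_poly L)"
    using degree_monic_char_poly[of L n] by auto
  then have nz: "char_poly L \<noteq> 0" by auto
  have n: "n > 0" using order_degree[OF nz, of 0] assms deg by simp
  define K where "K = mat n n (\<lambda>(i, j). if j = 0 then 1 else (0 :: real))"
  have K: "K \<in> carrier_mat n n" by (simp add: K_def)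
  note eq = char_poly_add_first_column[OF n, folded K_def]
  have "[:- 0, 1:] ^ 2 dvd char_poly L"
    using assms order_divides by blast
  \<comment> \<open>One factor X of \<open>char_poly L\<close> is used up by the identity
    \<open>eq\<close>; the second one has to divide \<open>char_poly (L + K)\<close>.\<close>
  then have "[:0, 1:] * [:0, 1:] dvd [:0, 1:] * char_poly (L + K)"
    unfolding eq[symmetric] by (simp only: power2_eq_square minus_zero dvd_mult2)
  then have "[:0, 1:] dvd char_poly (L + K)"
    by (subst (asm) dvd_mult_cancel_left) auto
  then have "poly (char_poly (L + K)) 0 = 0"
    using poly_eq_0_iff_dvd[of "char_poly (L + K)" 0] by simp
  then have "eigenvalue (L + K) 0"
    using K by (subst eigenvalue_root_char_poly[of _ n]) auto
  then obtain v where v: "v \<in> carrier_vec n" "v \<noteq> 0\<^sub>v n" "(L + K) *\<^sub>v v = 0 \<cdot>\<^sub>v v"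
    using K by (auto simp: eigenvalue_def eigenvector_def)
  have Kv: "(K *\<^sub>v v) $ i = v $ 0" if "i < n" for i
  proof -
    have "(K *\<^sub>v v) $ i = (\<Sum>j<n. K $$ (i, j) * v $ j)"
      using that v(1) K by (auto simp: scalar_prod_def lessThan_atLeast0)
    also have "\<dots> = (\<Sum>j<n. if j = 0 then v $ j else 0)"
      using that by (intro sum.cong) (auto simp: K_def)
    finally show ?thesis using n by simp
  qed
  have row: "(\<Sum>j<n. b i j * (v $ i - v $ j)) + v $ 0 = 0" if "i < n" for i
  proof -
    have "(L *\<^sub>v v + K *\<^sub>v v) $ i = 0"
      using v K that add_mult_distrib_mat_vec[of L n n K v] by simp
    then show ?thesis
      using that v(1) K matrix_laplacian_mult_vec[OF v(1) that, of b] Kv[OF that] by simp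
  qed
  \<comment> \<open>Summing all rows removes the Laplacian part and leaves
    \<open>n * v $ 0 = 0\<close>.\<close>
  have v0: "v $ 0 = 0"
  proof -
    let ?s = "\<Sum>i<n. \<Sum>j<n. b i j * (v $ i - v $ j)"
    have "?s = 0" by (rule sum_weighted_differences)
    moreover have "?s = (\<Sum>i<n. - (v $ 0))"
      using row by (intro sum.cong) (auto simp: eq_neg_iff_add_eq_0)
    ultimately show ?thesis using n by simp
  qed
  have ker: "L *\<^sub>v v = 0 \<cdot>\<^sub>v v"
  proof (rule eq_vecI)
    fix i assume "i < dim_vec (0 \<cdot>\<^sub>v v)"
    then have i: "i < n" using v(1) by simp
    show "(L *\<^sub>v v) $ i = (0 \<cdot>\<^sub>v v) $ i"
      unfolding matrix_laplacian_mult_vec[OF v(1) i] using row[OF i] v0 v(1) i by simp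
  qed (use v(1) in simp)
  show thesis
  proof (rule that[of "\<lambda>i. v $ i"])
    fix i j assume ij: "i < n" "j < n" "b i j \<noteq> 0"
    have "(\<Sum>i<n. \<Sum>j<n. b i j * (v $ i - v $ j)\<^sup>2) = 0"
      using quadratic_form[OF v(1) ker] by simp
    then have "b i j * (v $ i - v $ j)\<^sup>2 = 0"
      using ij by (auto simp: sum_nonneg_eq_0_iff sum_nonneg nonneg)
    then show "v $ i = v $ j" using ij by simp
  next
    obtain i where "i < n" "v $ i \<noteq> 0"
      using v(1,2) by (metis carrier_vecD eq_vecI index_zero_vec)
    then show "\<exists>i<n. \<exists>j<n. v $ i \<noteq> v $ j" using n v0 by metis
  qed
qed

end


section \<open>Graphs as weight functions\<close>

lemma vertex_list:
  assumes "finite V"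
  shows "distinct (vertex_list V)" "set (vertex_list V) = V" "length (vertex_list V) = card V"
proof -
  have "distinct (vertex_list V) \<and> set (vertex_list V) = V"
    unfolding vertex_list_def by (rule someI_ex) (use finite_distinct_list[OF assms] in blast)
  then show "distinct (vertex_list V)" "set (vertex_list V) = V" "length (vertex_list V) = card V"
    by (auto dest: distinct_card)
qed

text \<open>Edges are unordered pairs, so this is symmetric with values 0 and 1 at all natural
  indices, even beyond the vertex list. The interpretation below is therefore unconditional.\<close>

definition adjacency :: "'a set \<Rightarrow> 'a set set \<Rightarrow> nat \<Rightarrow> nat \<Rightarrow> real" where
  "adjacency V E i j = of_bool ({vertex_list V ! i, vertex_list V ! j} \<in> E)"

interpretation adjacency: weight_matrix n "adjacency V E" for n V E
  by unfold_locales (auto simp: adjacency_def insert_commute)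

lemma adjacency_diag:
  assumes "simple_graph V E"
  shows "adjacency V E i i = 0"
  using assms by (auto simp: adjacency_def simple_graph_def dest: bspec)

text \<open>The edges at a vertex correspond bijectively to the positions of its neighbours;
  injectivity comes from the distinctness of the vertex list.\<close>

lemma degree_of_vertex_list:
  assumes "simple_graph V E" "i < card V"
  shows "real (degree_of E (vertex_list V ! i)) = (\<Sum>l<card V. adjacency V E i l)"
proof -
  let ?v = "\<lambda>i. vertex_list V ! i"
  have V: "finite V" and E: "\<And>e. e \<in> E \<Longrightarrow> e \<subseteq> V \<and> card e = 2"
    using assms(1) by (auto simp: simple_graph_def)
  note vs = vertex_list[OF V]
  let ?N = "{l\<in>{..<card V}. {?v i, ?v l} \<in> E}"
  have "{e \<in> E. ?v i \<in> e} = (\<lambda>l. {?v i, ?v l}) ` ?N"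
  proof (intro equalityI subsetI)
    fix e assume e: "e \<in> {e \<in> E. ?v i \<in> e}"
    then obtain a c where "e = {a, c}" using E[of e] by (auto simp: card_2_iff)
    with e obtain u where u: "e = {?v i, u}" by auto
    then have "u \<in> set (vertex_list V)" using e E vs by auto
    then obtain l where "l < card V" "?v l = u" unfolding in_set_conv_nth vs(3) by blast
    then show "e \<in> (\<lambda>l. {?v i, ?v l}) ` ?N" using u e by auto
  qed auto
  moreover have "inj_on (\<lambda>l. {?v i, ?v l}) ?N"
    using vs by (intro inj_onI) (auto simp: doubleton_eq_iff nth_eq_iff_index_eq)
  ultimately have "degree_of E (?v i) = card ?N"
    by (simp add: degree_of_def card_image)
  then show ?thesis
    by (simp add: adjacency_def sum.If_cases of_bool_def Int_def)
qed

text \<open>The results on \<open>matrix_laplacian\<close> reach graphs through this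
  equation.\<close>

lemma laplacian_matrix_eq:
  assumes "simple_graph V E"
  shows "laplacian_matrix V E = matrix_laplacian (card V) (adjacency V E)"
  by (rule eq_matI)
    (auto simp: laplacian_matrix_def degree_matrix_def adjacency_matrix_def matrix_laplacian_index
      degree_of_vertex_list[OF assms] adjacency_def)

lemma simple_graph_complement: "simple_graph V E \<Longrightarrow> simple_graph V (complement_edges V E)"
  by (auto simp: simple_graph_def complement_edges_def)

text \<open>Entrywise form of the fact that the two adjacency matrices add up to J - I, with J the
  all-ones matrix: two distinct listed vertices form a two-element subset of \<open>V\<close>, which
  lies in exactly one of the edge sets.\<close>

lemma adjacency_complement:
  assumes "simple_graph V E" "i < card V" "j < card V"
  shows "adjacency V (complement_edges V E) i j = of_bool (i \<noteq> j) - adjacency V E i j"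
proof (cases "i = j")
  case True
  then show ?thesis using assms(1) simple_graph_complement[OF assms(1)] by (simp add: adjacency_diag)
next
  case False
  have "finite V" using assms by (simp add: simple_graph_def)
  note vs = vertex_list[OF this]
  have "vertex_list V ! i \<noteq> vertex_list V ! j"
    using False assms vs by (simp add: nth_eq_iff_index_eq)
  moreover have "vertex_list V ! i \<in> V" "vertex_list V ! j \<in> V"
    using assms nth_mem[of i "vertex_list V"] nth_mem[of j "vertex_list V"]
    unfolding vs(2,3) by blast+
  ultimately show ?thesis
    using False by (auto simp: adjacency_def complement_edges_def)
qed

lemma proots_linear_factors:
  fixes xs :: "'a :: idom list"
  shows "proots (\<Prod>a\<leftarrow>xs. [:- a, 1:]) = mset xs"
proof (induction xs)
  case (Cons a xs)
  have "(\<Prod>a\<leftarrow>xs. [:- a, 1:]) \<noteq> 0" by (auto simp: prod_list_zero_iff)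
  then show ?case using Cons
    by (simp only: list.map prod_list.Cons) (subst proots_mult, auto)
qed auto

section \<open>Sums of Laplacian eigenvalues\<close>

context
  fixes V :: "'a set" and E :: "'a set set"
  assumes graph: "simple_graph V E"
begin

lemma laplacian_matrix_carrier: "laplacian_matrix V E \<in> carrier_mat (card V) (card V)"
  by (simp add: laplacian_matrix_eq[OF graph])

lemma char_poly_laplacian_nonzero: "char_poly (laplacian_matrix V E) \<noteq> 0"
  using degree_monic_char_poly[OF laplacian_matrix_carrier] by auto

lemma mset_laplacian_eigenvalues:
  "mset (laplacian_eigenvalues V E) = proots (char_poly (laplacian_matrix V E))"
  by (simp add: laplacian_eigenvalues_def)

lemma set_laplacian_eigenvalues:
  "x \<in> set (laplacian_eigenvalues V E) \<longleftrightarrow> eigenvalue (laplacian_matrix V E) x"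
proof -
  have "x \<in> set (laplacian_eigenvalues V E) \<longleftrightarrow> x \<in># mset (laplacian_eigenvalues V E)" by simp
  then show ?thesis
    unfolding mset_laplacian_eigenvalues eigenvalue_root_char_poly[OF laplacian_matrix_carrier]
    using char_poly_laplacian_nonzero by simp
qed

text \<open>\<open>proots\<close> collects real roots only; the splitting of the characteristic
  polynomial over the reals ensures that no eigenvalue is missing from the list.\<close>

lemma length_laplacian_eigenvalues: "length (laplacian_eigenvalues V E) = card V" (is ?length)
  and sum_list_laplacian_eigenvalues:
    "sum_list (laplacian_eigenvalues V E) = (\<Sum>i<card V. laplacian_matrix V E $$ (i, i))" (is ?sum)
proof -
  obtain es where es: "char_poly (laplacian_matrix V E) = (\<Prod>a\<leftarrow>es. [:- a, 1:])"
    by (rule symmetric_real_mat_char_poly_splits[OF laplacian_matrix_carrier])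
      (auto simp: laplacian_matrix_eq[OF graph] matrix_laplacian_index adjacency.sym)
  have mset: "mset (laplacian_eigenvalues V E) = mset es"
    by (simp only: mset_laplacian_eigenvalues es proots_linear_factors)
  have "length es = degree (char_poly (laplacian_matrix V E))"
    unfolding es by (simp add: degree_linear_factors)
  then show ?length
    using degree_monic_char_poly[OF laplacian_matrix_carrier] mset_eq_length[OF mset] by simp
  show ?sum
    using arg_cong[OF mset, of sum_mset]
    by (simp only: sum_mset_sum_list trace_eq_sum_list_eigenvalues[OF laplacian_matrix_carrier es])
qed

lemma laplacian_eigenvalue_sum_eq:
  assumes "k \<le> card V"
  shows "laplacian_eigenvalue_sum k V E = sum_list (take k (laplacian_eigenvalues V E))"
  using assms length_laplacian_eigenvalues
  by (simp add: laplacian_eigenvalue_sum_def laplacian_eigenvalue_def sum.atLeast1_atMost_eq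
      sum_list_sum_nth lessThan_atLeast0)

lemma laplacian_eigenvalue_bounds:
  assumes "x \<in> set (laplacian_eigenvalues V E)"
  shows "0 \<le> x" "x \<le> card V"
  using assms adjacency.eigenvalue_nonneg adjacency.eigenvalue_le
  by (auto simp: set_laplacian_eigenvalues laplacian_matrix_eq[OF graph])

text \<open>The bound holds term by term, strictly if the dimension is not an eigenvalue;
  \<open>1 \<le> k\<close> provides a term for the strict case.\<close>

lemma laplacian_eigenvalue_sum_le_dim:
  assumes "1 \<le> k" "k \<le> card V"
  shows "laplacian_eigenvalue_sum k V E \<le> real k * card V"
    and "\<not> eigenvalue (laplacian_matrix V E) (card V) \<Longrightarrow> laplacian_eigenvalue_sum k V E < real k * card V"
proof -
  let ?es = "laplacian_eigenvalues V E"
  have eq: "laplacian_eigenvalue_sum k V E = (\<Sum>i<k. ?es ! i)"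
    by (simp add: laplacian_eigenvalue_sum_def laplacian_eigenvalue_def sum.atLeast1_atMost_eq)
  have mem: "?es ! i \<in> set ?es" if "i < k" for i
    using that assms length_laplacian_eigenvalues by simp
  have "(\<Sum>i<k. ?es ! i) \<le> (\<Sum>i<k. real (card V))"
    using laplacian_eigenvalue_bounds(2)[OF mem] by (intro sum_mono) auto
  then show "laplacian_eigenvalue_sum k V E \<le> real k * card V" by (simp add: eq)
  assume "\<not> eigenvalue (laplacian_matrix V E) (card V)"
  then have "real (card V) \<notin> set ?es" by (simp add: set_laplacian_eigenvalues)
  then have "?es ! i < real (card V)" if "i < k" for i
    using laplacian_eigenvalue_bounds(2)[OF mem[OF that]] mem[OF that] by (metis order_le_less)
  then have "(\<Sum>i<k. ?es ! i) < (\<Sum>i<k. real (card V))"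
    using assms by (intro sum_strict_mono) (auto simp: lessThan_empty_iff)
  then show "laplacian_eigenvalue_sum k V E < real k * card V" by (simp add: eq)
qed

text \<open>The trace exceeds the sum by the remaining \<open>card V - k\<close> eigenvalues, which
  are nonnegative. If they sum to 0, all of them are 0, and the root 0 has order at least
  \<open>card V - k\<close>.\<close>

lemma laplacian_eigenvalue_sum_le_trace:
  assumes "k \<le> card V"
  shows "laplacian_eigenvalue_sum k V E \<le> (\<Sum>i<card V. laplacian_matrix V E $$ (i, i))"
    and "Polynomial.order 0 (char_poly (laplacian_matrix V E)) < card V - k \<Longrightarrow>
      laplacian_eigenvalue_sum k V E < (\<Sum>i<card V. laplacian_matrix V E $$ (i, i))"
proof -
  let ?es = "laplacian_eigenvalues V E"
  have eq: "(\<Sum>i<card V. laplacian_matrix V E $$ (i, i))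
      = laplacian_eigenvalue_sum k V E + sum_list (drop k ?es)"
    unfolding laplacian_eigenvalue_sum_eq[OF assms] sum_list_laplacian_eigenvalues[symmetric]
    by (metis append_take_drop_id sum_list_append)
  have nonneg: "0 \<le> x" if "x \<in> set (drop k ?es)" for x
    using that laplacian_eigenvalue_bounds(1) in_set_dropD by fastforce
  then have ge: "0 \<le> sum_list (drop k ?es)" by (rule sum_list_nonneg)
  then show "laplacian_eigenvalue_sum k V E \<le> (\<Sum>i<card V. laplacian_matrix V E $$ (i, i))"
    by (simp add: eq)
  assume order: "Polynomial.order 0 (char_poly (laplacian_matrix V E)) < card V - k"
  have "sum_list (drop k ?es) \<noteq> 0"
  proof
    assume "sum_list (drop k ?es) = 0"
    then have "\<forall>x\<in>set (drop k ?es). x = 0"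
      using nonneg by (simp add: sum_list_nonneg_eq_0_iff)
    then have "drop k ?es = replicate (card V - k) 0"
      by (intro replicate_eqI) (auto simp: length_laplacian_eigenvalues)
    then have "card V - k \<le> count (mset (take k ?es) + mset (drop k ?es)) 0" by simp
    also have "mset (take k ?es) + mset (drop k ?es) = mset ?es"
      by (metis append_take_drop_id mset_append)
    also have "count (mset ?es) 0 = Polynomial.order 0 (char_poly (laplacian_matrix V E))"
      using char_poly_laplacian_nonzero by (simp add: mset_laplacian_eigenvalues)
    finally show False using order by simp
  qed
  then show "laplacian_eigenvalue_sum k V E < (\<Sum>i<card V. laplacian_matrix V E $$ (i, i))"
    using ge by (simp add: eq)
qed

text \<open>At each vertex the degrees in the graph and in its complement add up to
  \<open>card V - 1\<close>.\<close>

lemma trace_laplacian_add_complement: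
  "(\<Sum>i<card V. laplacian_matrix V E $$ (i, i)) + (\<Sum>i<card V. laplacian_matrix V (complement_edges V E) $$ (i, i))
    = real (card V) * (real (card V) - 1)"
proof -
  have tr: "(\<Sum>i<card V. laplacian_matrix V F $$ (i, i)) = (\<Sum>i<card V. \<Sum>j<card V. adjacency V F i j)"
    if "simple_graph V F" for F
    by (intro sum.cong) (auto simp: laplacian_matrix_eq[OF that] matrix_laplacian_index adjacency_diag[OF that])
  have "(\<Sum>i<card V. laplacian_matrix V E $$ (i, i)) + (\<Sum>i<card V. laplacian_matrix V (complement_edges V E) $$ (i, i))
      = (\<Sum>i<card V. \<Sum>j<card V. adjacency V E i j + adjacency V (complement_edges V E) i j)"
    by (simp add: tr graph simple_graph_complement sum.distrib)
  also have "\<dots> = (\<Sum>i<card V. \<Sum>j<card V. 1 - (if i = j then 1 else 0))"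
    by (intro sum.cong) (auto simp: adjacency_complement[OF graph])
  also have "\<dots> = real (card V) * (real (card V) - 1)"
    by (simp add: sum_subtractf)
  finally show ?thesis .
qed

end

section \<open>Strictness of the two bounds\<close>

text \<open>Otherwise take \<open>a\<close> and \<open>c\<close> separated by \<open>v\<close>, so
  that \<open>w a = w c\<close>. Every \<open>i\<close> is separated by \<open>v\<close> from
  \<open>a\<close> or from \<open>c\<close>, hence \<open>w i\<close> is that common value and
  \<open>w\<close> is constant.\<close>

lemma two_nonconstant_functions_separate_pair:
  assumes "\<exists>i\<in>A. \<exists>j\<in>A. v i \<noteq> v j" and "\<exists>i\<in>A. \<exists>j\<in>A. w i \<noteq> w j"
  shows "\<exists>i\<in>A. \<exists>j\<in>A. v i \<noteq> v j \<and> w i \<noteq> w j"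
proof (rule ccontr)
  assume "\<not> ?thesis"
  then have eq: "v i = v j \<or> w i = w j" if "i \<in> A" "j \<in> A" for i j
    using that by blast
  obtain a c where ac: "a \<in> A" "c \<in> A" "v a \<noteq> v c" using assms(1) by blast
  have "w i = w a" if "i \<in> A" for i
  proof (cases "v i = v a")
    case True
    then show ?thesis using eq[OF that ac(2)] eq[OF ac(1,2)] ac(3) by simp
  next
    case False
    then show ?thesis using eq[OF that ac(1)] by blast
  qed
  with assms(2) show False by metis
qed

text \<open>A pair separated by both functions would have weight 1 in the graph and in its
  complement, so it would be an edge of both.\<close>

lemma not_both_eigenvalue_dim:
  assumes graph: "simple_graph V E"
  shows "\<not> (eigenvalue (laplacian_matrix V E) (card V) \<and>
    eigenvalue (laplacian_matrix V (complement_edges V E)) (card V))"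
proof
  note graph' = simple_graph_complement[OF graph]
  assume "eigenvalue (laplacian_matrix V E) (card V) \<and>
    eigenvalue (laplacian_matrix V (complement_edges V E)) (card V)"
  then have *: "eigenvalue (matrix_laplacian (card V) (adjacency V E)) (card V)"
    "eigenvalue (matrix_laplacian (card V) (adjacency V (complement_edges V E))) (card V)"
    by (simp_all add: laplacian_matrix_eq[OF graph] laplacian_matrix_eq[OF graph'])
  obtain v :: "nat \<Rightarrow> real" where v:
    "\<And>i j. i < card V \<Longrightarrow> j < card V \<Longrightarrow> adjacency V E i j \<noteq> 1 \<Longrightarrow> v i = v j"
    "\<exists>i<card V. \<exists>j<card V. v i \<noteq> v j"
    using adjacency.eigenvalue_eq_dim_nonconstant[OF *(1)] by blast
  obtain w :: "nat \<Rightarrow> real" where w: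
    "\<And>i j. i < card V \<Longrightarrow> j < card V \<Longrightarrow> adjacency V (complement_edges V E) i j \<noteq> 1 \<Longrightarrow> w i = w j"
    "\<exists>i<card V. \<exists>j<card V. w i \<noteq> w j"
    using adjacency.eigenvalue_eq_dim_nonconstant[OF *(2)] by blast
  obtain i j where ij: "i < card V" "j < card V" "v i \<noteq> v j" "w i \<noteq> w j"
    using two_nonconstant_functions_separate_pair[of "{..<card V}" v w] v(2) w(2) by auto
  have "i \<noteq> j" using ij(3) by blast
  moreover have "adjacency V E i j = 1" "adjacency V (complement_edges V E) i j = 1"
    using v(1)[OF ij(1,2)] w(1)[OF ij(1,2)] ij(3,4) by blast+
  ultimately show False
    using adjacency_complement[OF graph ij(1,2)] by simp
qed

text \<open>Dual to the previous lemma: a pair separated by both functions would be an edge of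
  neither graph, although its vertices are distinct.\<close>

lemma not_both_order_0_ge_2:
  assumes graph: "simple_graph V E"
  shows "\<not> (Polynomial.order 0 (char_poly (laplacian_matrix V E)) \<ge> 2 \<and>
    Polynomial.order 0 (char_poly (laplacian_matrix V (complement_edges V E))) \<ge> 2)"
proof
  note graph' = simple_graph_complement[OF graph]
  assume "Polynomial.order 0 (char_poly (laplacian_matrix V E)) \<ge> 2 \<and>
    Polynomial.order 0 (char_poly (laplacian_matrix V (complement_edges V E))) \<ge> 2"
  then have *: "Polynomial.order 0 (char_poly (matrix_laplacian (card V) (adjacency V E))) \<ge> 2"
    "Polynomial.order 0 (char_poly (matrix_laplacian (card V) (adjacency V (complement_edges V E)))) \<ge> 2"
    by (simp_all add: laplacian_matrix_eq[OF graph] laplacian_matrix_eq[OF graph'])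
  obtain v :: "nat \<Rightarrow> real" where v:
    "\<And>i j. i < card V \<Longrightarrow> j < card V \<Longrightarrow> adjacency V E i j \<noteq> 0 \<Longrightarrow> v i = v j"
    "\<exists>i<card V. \<exists>j<card V. v i \<noteq> v j"
    using adjacency.order_0_nonconstant[OF *(1)] by blast
  obtain w :: "nat \<Rightarrow> real" where w:
    "\<And>i j. i < card V \<Longrightarrow> j < card V \<Longrightarrow> adjacency V (complement_edges V E) i j \<noteq> 0 \<Longrightarrow> w i = w j"
    "\<exists>i<card V. \<exists>j<card V. w i \<noteq> w j"
    using adjacency.order_0_nonconstant[OF *(2)] by blast
  obtain i j where ij: "i < card V" "j < card V" "v i \<noteq> v j" "w i \<noteq> w j"
    using two_nonconstant_functions_separate_pair[of "{..<card V}" v w] v(2) w(2) by auto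
  have "i \<noteq> j" using ij(3) by blast
  moreover have "adjacency V E i j = 0" "adjacency V (complement_edges V E) i j = 0"
    using v(1)[OF ij(1,2)] w(1)[OF ij(1,2)] ij(3,4) by blast+
  ultimately show False
    using adjacency_complement[OF graph ij(1,2)] by simp
qed

section \<open>Arithmetic of the two ranges of \<open>k\<close>\<close>

lemma of_nat_choose_two: "real (n choose 2) = real n * (real n - 1) / 2"
  by (induction n) (auto simp: numeral_2_eq_2 field_simps)

lemma phi_nonneg: "0 \<le> phi n"
  and phi_squared: "(phi n)\<^sup>2 = 2 * (real n)\<^sup>2 - 2 * real n + 1"
proof -
  have "2 * (real n)\<^sup>2 - 2 * real n + 1 = (real n)\<^sup>2 + (real n - 1)\<^sup>2"
    by (simp add: power2_eq_square algebra_simps)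
  then have "0 \<le> 2 * (real n)\<^sup>2 - 2 * real n + 1" by (metis sum_power2_ge_zero)
  then show "0 \<le> phi n" "(phi n)\<^sup>2 = 2 * (real n)\<^sup>2 - 2 * real n + 1"
    by (simp_all add: phi_def)
qed

theorem theorem3p7:
  fixes V :: "'a set" and E :: "'a set set" and n k :: nat
  assumes "simple_graph V E" and "card V = n"
    and "(1 \<le> k \<and> real k \<le> real n - (phi n + 1) / 2) \<or>
         ((phi n - 1) / 2 \<le> real k \<and> real k \<le> real n - 2)"
  shows "laplacian_eigenvalue_sum k V E + laplacian_eigenvalue_sum k V (complement_edges V E)
           < real (n choose 2) + 2 * real ((k + 1) choose 2)"
proof -
  note graph' = simple_graph_complement[OF assms(1)]
  have choose: "real (n choose 2) = real n * (real n - 1) / 2"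
    "2 * real ((k + 1) choose 2) = (real k + 1) * real k"
    unfolding of_nat_choose_two by simp_all
  from assms(3) show ?thesis
  proof
    assume "1 \<le> k \<and> real k \<le> real n - (phi n + 1) / 2"
    then have k: "1 \<le> k" "phi n \<le> 2 * (real n - real k) - 1" by argo+
    \<comment> \<open>As \<open>phi n\<close> is nonnegative, \<open>2 * (real n - real k)\<close>
      is at least 1.\<close>
    then have "real k \<le> real (card V)" unfolding assms(2) using phi_nonneg[of n] by argo
    then have "k \<le> card V" by simp
    note le = laplacian_eigenvalue_sum_le_dim[OF assms(1) k(1) this, unfolded assms(2)]
      laplacian_eigenvalue_sum_le_dim[OF graph' k(1) this, unfolded assms(2)]
    have "laplacian_eigenvalue_sum k V E + laplacian_eigenvalue_sum k V (complement_edges V E)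
        < 2 * real k * n"
    proof (cases "eigenvalue (laplacian_matrix V E) n")
      case True
      then have "\<not> eigenvalue (laplacian_matrix V (complement_edges V E)) n"
        using not_both_eigenvalue_dim[OF assms(1)] by (simp add: assms(2))
      from add_le_less_mono[OF le(1) le(4)[OF this]] show ?thesis by simp
    next
      case False
      from add_less_le_mono[OF le(2)[OF this] le(3)] show ?thesis by simp
    qed
    \<comment> \<open>Both sides of the range condition are nonnegative, so it may be squared.
      Expanding and dividing by 4 compares \<open>2 * k * n\<close> with the right-hand side of the
      theorem.\<close>
    moreover have "(phi n)\<^sup>2 \<le> (2 * (real n - real k) - 1)\<^sup>2"
      using k phi_nonneg by (intro power_mono) auto
    then have "4 * (2 * real k * n) \<le> 2 * (real n * (real n - 1)) + 4 * ((real k + 1) * real k)"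
      unfolding phi_squared by (simp add: power2_eq_square algebra_simps)
    then have "2 * real k * n \<le> real (n choose 2) + 2 * real ((k + 1) choose 2)"
      unfolding choose by argo
    ultimately show ?thesis by (rule less_le_trans)
  next
    assume "(phi n - 1) / 2 \<le> real k \<and> real k \<le> real n - 2"
    then have k: "phi n \<le> 2 * real k + 1" "real k \<le> real n - 2" by argo+
    then have "real (k + 2) \<le> real n" by simp
    then have k2: "k + 2 \<le> n" by (simp only: of_nat_le_iff)
    then have "k \<le> card V" using assms(2) by simp
    note le = laplacian_eigenvalue_sum_le_trace[OF assms(1) this, unfolded assms(2)]
      laplacian_eigenvalue_sum_le_trace[OF graph' this, unfolded assms(2)]
    note trace = trace_laplacian_add_complement[OF assms(1), unfolded assms(2)]
    have two_le: "2 \<le> n - k" using k2 by simp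
    \<comment> \<open>Here \<open>k \<le> n - 2\<close> enters: at least two eigenvalues are left
      out of each sum, while 0 is a multiple root for at most one of the two graphs.\<close>
    have "Polynomial.order 0 (char_poly (laplacian_matrix V E)) < n - k \<or>
        Polynomial.order 0 (char_poly (laplacian_matrix V (complement_edges V E))) < n - k"
      using not_both_order_0_ge_2[OF assms(1)] two_le by (meson not_less order_trans)
    then have "laplacian_eigenvalue_sum k V E + laplacian_eigenvalue_sum k V (complement_edges V E)
        < real n * (real n - 1)"
    proof
      assume "Polynomial.order 0 (char_poly (laplacian_matrix V E)) < n - k"
      from add_less_le_mono[OF le(2)[OF this] le(3), unfolded trace] show ?thesis .
    next
      assume "Polynomial.order 0 (char_poly (laplacian_matrix V (complement_edges V E))) < n - k"
      from add_le_less_mono[OF le(1) le(4)[OF this], unfolded trace] show ?thesis .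
    qed
    \<comment> \<open>Squaring the range condition gives
      \<open>n * (n - 1) / 2 \<le> k * (k + 1)\<close>; adding \<open>n choose 2\<close> to both
      sides bounds the sum of the traces.\<close>
    moreover have "(phi n)\<^sup>2 \<le> (2 * real k + 1)\<^sup>2"
      using k phi_nonneg by (intro power_mono) auto
    then have "2 * (real n * (real n - 1)) \<le> 4 * ((real k + 1) * real k)"
      unfolding phi_squared by (simp add: power2_eq_square algebra_simps)
    then have "real n * (real n - 1) \<le> real (n choose 2) + 2 * real ((k + 1) choose 2)"
      unfolding choose by argo
    ultimately show ?thesis by (rule less_le_trans)
  qed
qed

end
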